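(* Let $B_1$ and $B_2$ be two associative algebras and $M$ a $B_1$-$B_2$ bimodule. Assume that there exist an algebra isomorphism $b\colon B_1\to B_2$ and an element $\psi\in M$ such that $$P\psi=\psi\,b(P),\qquad\forall P\in B_1.$$ Assume that $A_i$ and $K_i$ are subalgebras of $B_i$ ($i=1,2$) such that $b(A_1)=K_2$ and $b(K_1)=A_2$, and for which the following conditions are satisfied: (1) $r(K_i)$ are Ore subsets of $B_i$ consisting of regular elements, and (2) $\operatorname{Ann}_f(M)=0$ for all $f\in r(K_i)$. If $L=Qg^{-1}P$ for some $L\in A_1$, $P,Q\in B_1$, and $g\in r(K_1)$, then $\varphi:=P\psi=\psi\,b(P)$ satisfies $$\left(PQg^{-1}\right)\varphi=\varphi\,b(L),$$ $$g\varphi=\varphi\left(b(L)^{-1}b(Q)b(P)\right).$$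
   Context: For a ring $R$, $r(R)$ denotes the multiplicative subset of its regular elements (elements that are not zero divisors). A subset $E$ of a unital ring $R$ is multiplicative if it is closed under multiplication and contains $1$. A multiplicative subset $E$ of regular elements is a (left) Ore set if for all $e\in E$, $r\in R$ there exist $h\in E$, $t\in R$ with $hr=te$; then the localized ring $R[E^{-1}]$ of left fractions $e^{-1}r$ exists and $R$ embeds in it. $\operatorname{Ann}_f(M)$ is the set of elements of $M$ annihilated by $f$ (acting from the left for $f\in B_1$ and from the right for $f\in B_2$). Note that $b(L)\in K_2$. Conditions (1) and (2) ensure that the algebras $B_i$ embed in $B_i[r(K_i)^{-1}]$ and $M$ embeds in $M[r(K_1)^{-1}][r(K_2)^{-1}]$. Both equalities in the conclusion take place in this localized module.
   Formalization: The second identity is stated only when b(L) is in r(K_2), so that b(L)^{-1} exists, and when P is a regular element of B_1; without regularity of P it can fail (e.g. shift operators with P=GS, Q=T, g=G). The first identity is unconditional. *)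

theory Defs
  imports Complex_Main
begin

section \<open>Algebras, subalgebras and isomorphisms\<close>

text \<open>Unital associative algebras over a commutative ground ring; an algebra over a field is
  the special case where the type of scalars is a field.\<close>

locale assoc_algebra = module scale
  for scale :: "'k::comm_ring_1 \<Rightarrow> 'a::ring_1 \<Rightarrow> 'a" +
  assumes scale_mult_left: "scale c x * y = scale c (x * y)"
    and scale_mult_right: "x * scale c y = scale c (x * y)"
begin

definition subalgebra :: "'a set \<Rightarrow> bool" where
  "subalgebra A \<longleftrightarrow> subspace A \<and> 1 \<in> A \<and> (\<forall>x\<in>A. \<forall>y\<in>A. x * y \<in> A)"

end

definition ring_homomorphism :: "('a::ring_1 \<Rightarrow> 'b::ring_1) \<Rightarrow> bool" where
  "ring_homomorphism f \<longleftrightarrow>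
     (\<forall>x y. f (x + y) = f x + f y) \<and> (\<forall>x y. f (x * y) = f x * f y) \<and> f 1 = 1"

definition algebra_isomorphism ::
  "('k \<Rightarrow> 'a \<Rightarrow> 'a) \<Rightarrow> ('k \<Rightarrow> 'b \<Rightarrow> 'b) \<Rightarrow> ('a::ring_1 \<Rightarrow> 'b::ring_1) \<Rightarrow> bool" where
  "algebra_isomorphism s1 s2 f \<longleftrightarrow>
     bij f \<and> ring_homomorphism f \<and> (\<forall>c x. f (s1 c x) = s2 c (f x))"


section \<open>Bimodules\<close>

text \<open>\<open>lact a m\<close> is the left action and \<open>ract m b\<close> the right action.\<close>

locale bimodule =
  fixes lact :: "'a::ring_1 \<Rightarrow> 'm::ab_group_add \<Rightarrow> 'm"
    and ract :: "'m \<Rightarrow> 'b::ring_1 \<Rightarrow> 'm"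
  assumes lact_add_right: "lact a (m + n) = lact a m + lact a n"
    and lact_add_left: "lact (a + a') m = lact a m + lact a' m"
    and lact_mult: "lact (a * a') m = lact a (lact a' m)"
    and lact_one: "lact 1 m = m"
    and ract_add_left: "ract (m + n) b = ract m b + ract n b"
    and ract_add_right: "ract m (b + b') = ract m b + ract m b'"
    and ract_mult: "ract m (b * b') = ract (ract m b) b'"
    and ract_one: "ract m 1 = m"
    and lact_ract: "ract (lact a m) b = lact a (ract m b)"

text \<open>For algebras the two actions must induce the same action of the scalars.\<close>

locale algebra_bimodule =
  B1: assoc_algebra s1 + B2: assoc_algebra s2 + bimodule lact ract
  for s1 :: "'k::comm_ring_1 \<Rightarrow> 'a::ring_1 \<Rightarrow> 'a"
    and s2 :: "'k \<Rightarrow> 'b::ring_1 \<Rightarrow> 'b"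
    and lact :: "'a \<Rightarrow> 'm::ab_group_add \<Rightarrow> 'm"
    and ract :: "'m \<Rightarrow> 'b \<Rightarrow> 'm" +
  assumes scalars_central: "lact (s1 c 1) m = ract m (s2 c 1)"


section \<open>Regular elements and Ore sets\<close>

text \<open>Regularity in \<open>regular_elements K\<close> is relative to the subring \<open>K\<close>; the elements
  regular in the ambient ring are those of \<open>regular_elements UNIV\<close>.\<close>

definition regular_elements :: "'a::ring_1 set \<Rightarrow> 'a set" where
  "regular_elements K =
     {x \<in> K. \<forall>y\<in>K. (x * y = 0 \<longrightarrow> y = 0) \<and> (y * x = 0 \<longrightarrow> y = 0)}"

definition multiplicative_subset :: "'a::ring_1 set \<Rightarrow> bool" where
  "multiplicative_subset E \<longleftrightarrow> 1 \<in> E \<and> (\<forall>x\<in>E. \<forall>y\<in>E. x * y \<in> E)"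

definition ore_set :: "'a::ring_1 set \<Rightarrow> bool" where
  "ore_set E \<longleftrightarrow> multiplicative_subset E \<and> E \<subseteq> regular_elements UNIV \<and>
     (\<forall>e\<in>E. \<forall>r. \<exists>h\<in>E. \<exists>t. h * r = t * e)"


section \<open>Localization\<close>

definition is_inverse :: "'a::ring_1 \<Rightarrow> 'a \<Rightarrow> bool" where
  "is_inverse x y \<longleftrightarrow> x * y = 1 \<and> y * x = 1"

definition rinv :: "'a::ring_1 \<Rightarrow> 'a" where
  "rinv x = (THE y. is_inverse x y)"

text \<open>\<open>\<iota>\<close> exhibits the ring \<open>'c\<close> as the ring of left fractions \<open>R[E\<^sup>-\<^sup>1]\<close>
  (determined up to a unique isomorphism over \<open>R\<close>). Injectivity of \<open>\<iota>\<close> is not part of the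
  definition; it follows from the description of the kernel when \<open>E\<close> consists of regular
  elements. The same remark applies to the localizations of bimodules below.\<close>

definition ring_of_left_fractions :: "'a::ring_1 set \<Rightarrow> ('a \<Rightarrow> 'c::ring_1) \<Rightarrow> bool" where
  "ring_of_left_fractions E \<iota> \<longleftrightarrow>
     ring_homomorphism \<iota> \<and>
     (\<forall>e\<in>E. \<exists>y. is_inverse (\<iota> e) y) \<and>
     (\<forall>z. \<exists>e\<in>E. \<exists>r. z = rinv (\<iota> e) * \<iota> r) \<and>
     (\<forall>r. \<iota> r = 0 \<longleftrightarrow> (\<exists>e\<in>E. e * r = 0))"

text \<open>\<open>j\<close> exhibits the bimodule \<open>'n\<close> as \<open>[E\<^sup>-\<^sup>1]M\<close>, obtained by localizing the left
  action of \<open>'a\<close> at \<open>E\<close>: its elements are the fractions \<open>e\<^sup>-\<^sup>1 m\<close>.\<close>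

definition left_localization ::
  "'a::ring_1 set \<Rightarrow> ('a \<Rightarrow> 'c::ring_1)
   \<Rightarrow> ('a \<Rightarrow> 'm::ab_group_add \<Rightarrow> 'm) \<Rightarrow> ('m \<Rightarrow> 'b::ring_1 \<Rightarrow> 'm)
   \<Rightarrow> ('c \<Rightarrow> 'n::ab_group_add \<Rightarrow> 'n) \<Rightarrow> ('n \<Rightarrow> 'b \<Rightarrow> 'n) \<Rightarrow> ('m \<Rightarrow> 'n) \<Rightarrow> bool" where
  "left_localization E \<iota> lact ract lact' ract' j \<longleftrightarrow>
     bimodule lact' ract' \<and>
     (\<forall>m n. j (m + n) = j m + j n) \<and>
     (\<forall>a m. j (lact a m) = lact' (\<iota> a) (j m)) \<and>
     (\<forall>m b. j (ract m b) = ract' (j m) b) \<and>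
     (\<forall>n. \<exists>e\<in>E. \<exists>m. n = lact' (rinv (\<iota> e)) (j m)) \<and>
     (\<forall>m. j m = 0 \<longleftrightarrow> (\<exists>e\<in>E. lact e m = 0))"

text \<open>The mirror image: the right action of \<open>'b\<close> is localized at \<open>E\<close>, and the elements
  are the fractions \<open>m e\<^sup>-\<^sup>1\<close>.\<close>

definition right_localization ::
  "'b::ring_1 set \<Rightarrow> ('b \<Rightarrow> 'd::ring_1)
   \<Rightarrow> ('a::ring_1 \<Rightarrow> 'm::ab_group_add \<Rightarrow> 'm) \<Rightarrow> ('m \<Rightarrow> 'b \<Rightarrow> 'm)
   \<Rightarrow> ('a \<Rightarrow> 'n::ab_group_add \<Rightarrow> 'n) \<Rightarrow> ('n \<Rightarrow> 'd \<Rightarrow> 'n) \<Rightarrow> ('m \<Rightarrow> 'n) \<Rightarrow> bool" where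
  "right_localization E \<iota> lact ract lact' ract' j \<longleftrightarrow>
     bimodule lact' ract' \<and>
     (\<forall>m n. j (m + n) = j m + j n) \<and>
     (\<forall>a m. j (lact a m) = lact' a (j m)) \<and>
     (\<forall>m b. j (ract m b) = ract' (j m) (\<iota> b)) \<and>
     (\<forall>n. \<exists>e\<in>E. \<exists>m. n = ract' (j m) (rinv (\<iota> e))) \<and>
     (\<forall>m. j m = 0 \<longleftrightarrow> (\<exists>e\<in>E. ract m e = 0))"

end

theory Submission
  imports Defs
begin

text \<open>The first identity is the regrouping \<open>P Q g\<^sup>-\<^sup>1 P = P L\<close> applied to \<open>\<psi>\<close>. For the second, the
  Ore condition at \<open>b L\<close> yields \<open>b h b P = b t b L\<close>, that is \<open>b P (b L)\<^sup>-\<^sup>1 = (b h)\<^sup>-\<^sup>1 b t\<close>. In the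
  left fractions \<open>h P = t Q g\<^sup>-\<^sup>1 P\<close>, and cancelling \<open>P\<close> gives \<open>h g = t Q\<close>; hence
  \<open>b P (b L)\<^sup>-\<^sup>1 b Q = b g\<close>, which acts on \<open>\<psi>\<close> as \<open>g\<close> does.\<close>

lemma is_inverse_unique:
  assumes "is_inverse x y" and "is_inverse x z"
  shows "y = z"
proof -
  have "y = y * (x * z)" using assms by (simp add: is_inverse_def)
  also have "\<dots> = y * x * z" by (simp only: mult.assoc)
  also have "\<dots> = z" using assms by (simp add: is_inverse_def)
  finally show ?thesis .
qed

text \<open>\<open>rinv\<close> is a definite description, so it says something only once some
  inverse exists; uniqueness then identifies it.\<close>

lemma rinv_inverse:
  assumes "is_inverse x y"
  shows "x * rinv x = 1" and "rinv x * x = 1"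
proof -
  have "is_inverse x (rinv x)"
    unfolding rinv_def
    by (rule theI [where P = "is_inverse x", OF assms]) (rule is_inverse_unique [OF _ assms])
  then show "x * rinv x = 1" and "rinv x * x = 1"
    by (simp_all add: is_inverse_def)
qed

context
  fixes E :: "'a::ring_1 set" and \<iota> :: "'a \<Rightarrow> 'c::ring_1"
  assumes fractions: "ring_of_left_fractions E \<iota>"
begin

lemma fractions_mult: "\<iota> (x * y) = \<iota> x * \<iota> y"
  using fractions by (simp add: ring_of_left_fractions_def ring_homomorphism_def)

lemma fractions_diff: "\<iota> (x - y) = \<iota> x - \<iota> y"
proof -
  have "\<iota> (x - y + y) = \<iota> (x - y) + \<iota> y"
    using fractions unfolding ring_of_left_fractions_def ring_homomorphism_def by blast
  then show ?thesis by simp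
qed

lemma fractions_rinv:
  assumes "e \<in> E"
  shows "\<iota> e * rinv (\<iota> e) = 1" and "rinv (\<iota> e) * \<iota> e = 1"
proof -
  obtain y where "is_inverse (\<iota> e) y"
    using fractions assms unfolding ring_of_left_fractions_def by blast
  then show "\<iota> e * rinv (\<iota> e) = 1" and "rinv (\<iota> e) * \<iota> e = 1"
    by (rule rinv_inverse)+
qed

context
  assumes regular: "E \<subseteq> regular_elements UNIV"
begin

text \<open>The kernel of \<open>\<iota>\<close> is the left \<open>E\<close>-torsion, which
  vanishes because \<open>E\<close> is regular.\<close>

lemma fractions_eq_0_iff: "\<iota> x = 0 \<longleftrightarrow> x = 0"
proof
  assume "\<iota> x = 0"
  then obtain e where "e \<in> E" "e * x = 0"
    using fractions unfolding ring_of_left_fractions_def by blast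
  then show "x = 0"
    using regular unfolding regular_elements_def by blast
next
  assume "x = 0"
  then show "\<iota> x = 0" using fractions_diff [of x x] by simp
qed

lemma fractions_eq_iff: "\<iota> x = \<iota> y \<longleftrightarrow> x = y"
  using fractions_eq_0_iff [of "x - y"] by (simp add: fractions_diff)

text \<open>\<open>P\<close> need not become invertible. Since \<open>z - w\<close> is a left
  fraction \<open>e^-1 r\<close>, clearing \<open>e\<close> from the left does not disturb
  \<open>P\<close> on the right, and leaves \<open>r P = 0\<close> in the original ring.\<close>

lemma fractions_cancel_right:
  assumes P: "P \<in> regular_elements UNIV" and eq: "z * \<iota> P = w * \<iota> P"
  shows "z = w"
proof -
  obtain e r where e: "e \<in> E" and zw: "z - w = rinv (\<iota> e) * \<iota> r"
    using fractions unfolding ring_of_left_fractions_def by blast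
  have "\<iota> e * (z - w) = \<iota> r"
    by (simp add: zw fractions_rinv e flip: mult.assoc)
  moreover have "(z - w) * \<iota> P = 0"
    using eq by (simp add: left_diff_distrib)
  ultimately have "\<iota> r * \<iota> P = 0"
    by (metis mult.assoc mult_zero_right)
  then have "r * P = 0"
    by (simp add: fractions_eq_0_iff flip: fractions_mult)
  then have "r = 0"
    using P unfolding regular_elements_def by blast
  then have "\<iota> r = 0" by (simp add: fractions_eq_0_iff)
  then show "z = w" using zw by simp
qed

end

end

(* The second identity needs b(L) to be regular for b(L)^-1 to exist, and P to be regular for
   g = P L^-1 Q to follow from L = Q g^-1 P; without the latter it can fail. *)
theorem theorem2p1:
  fixes s1 :: "'k::comm_ring_1 \<Rightarrow> 'a::ring_1 \<Rightarrow> 'a"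
    and s2 :: "'k \<Rightarrow> 'b::ring_1 \<Rightarrow> 'b"
    and lact :: "'a \<Rightarrow> 'm::ab_group_add \<Rightarrow> 'm"
    and ract :: "'m \<Rightarrow> 'b \<Rightarrow> 'm"
    and b :: "'a \<Rightarrow> 'b"
    and \<psi> \<phi> :: 'm
    and A1 K1 :: "'a set"
    and A2 K2 :: "'b set"
    and \<iota>1 :: "'a \<Rightarrow> 'c::ring_1"
    and \<iota>2 :: "'b \<Rightarrow> 'd::ring_1"
    and lact1 :: "'c \<Rightarrow> 'm1::ab_group_add \<Rightarrow> 'm1"
    and ract1 :: "'m1 \<Rightarrow> 'b \<Rightarrow> 'm1"
    and lact2 :: "'c \<Rightarrow> 'm2::ab_group_add \<Rightarrow> 'm2"
    and ract2 :: "'m2 \<Rightarrow> 'd \<Rightarrow> 'm2"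
    and j1 :: "'m \<Rightarrow> 'm1"
    and j2 :: "'m1 \<Rightarrow> 'm2"
    and L P Q g :: 'a
  assumes "algebra_bimodule s1 s2 lact ract"
    and "algebra_isomorphism s1 s2 b"
    and "\<forall>P. lact P \<psi> = ract \<psi> (b P)"
    and "assoc_algebra.subalgebra s1 A1" and "assoc_algebra.subalgebra s1 K1"
    and "assoc_algebra.subalgebra s2 A2" and "assoc_algebra.subalgebra s2 K2"
    and "b ` A1 = K2" and "b ` K1 = A2"
    and "ore_set (regular_elements K1)" and "ore_set (regular_elements K2)"
    and "\<forall>f\<in>regular_elements K1. {m. lact f m = 0} = {0}"
    and "\<forall>f\<in>regular_elements K2. {m. ract m f = 0} = {0}"
    \<comment> \<open>\<open>B\<^sub>i[r(K\<^sub>i)\<^sup>-\<^sup>1]\<close>, \<open>M[r(K\<^sub>1)\<^sup>-\<^sup>1]\<close> and \<open>M[r(K\<^sub>1)\<^sup>-\<^sup>1][r(K\<^sub>2)\<^sup>-\<^sup>1]\<close>\<close>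
    and "ring_of_left_fractions (regular_elements K1) \<iota>1"
    and "ring_of_left_fractions (regular_elements K2) \<iota>2"
    and "left_localization (regular_elements K1) \<iota>1 lact ract lact1 ract1 j1"
    and "right_localization (regular_elements K2) \<iota>2 lact1 ract1 lact2 ract2 j2"
    and "L \<in> A1" and "g \<in> regular_elements K1"
    and "\<iota>1 L = \<iota>1 Q * rinv (\<iota>1 g) * \<iota>1 P"
    and "\<phi> = lact P \<psi>"
  shows "\<phi> = ract \<psi> (b P)
    \<and> lact2 (\<iota>1 P * \<iota>1 Q * rinv (\<iota>1 g)) (j2 (j1 \<phi>)) = ract2 (j2 (j1 \<phi>)) (\<iota>2 (b L))
    \<and> (b L \<in> regular_elements K2 \<longrightarrow> P \<in> regular_elements UNIV \<longrightarrow>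
        lact2 (\<iota>1 g) (j2 (j1 \<phi>))
          = ract2 (j2 (j1 \<phi>)) (rinv (\<iota>2 (b L)) * \<iota>2 (b Q) * \<iota>2 (b P)))"
proof -
  note iso = assms(2) and \<psi> = assms(3) [rule_format]
  note ore1 = assms(10) and ore2 = assms(11)
  note frac1 = assms(14) and frac2 = assms(15)
  note g = assms(19) and L_eq = assms(20) and \<phi> = assms(21)
  note loc1 = assms(16) [unfolded left_localization_def]
  note loc2 = assms(17) [unfolded right_localization_def]
  interpret M2: bimodule lact2 ract2
    using loc2 by blast
  have reg1: "regular_elements K1 \<subseteq> regular_elements UNIV"
    using ore1 by (simp add: ore_set_def)
  note cancel1 = fractions_cancel_right [OF frac1 reg1]
  have surj_b: "surj b" and inj_b: "inj b" and b_mult: "b (x * y) = b x * b y" for x y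
    using iso by (simp_all add: algebra_isomorphism_def bij_def ring_homomorphism_def)
  \<comment> \<open>The composite map into the iterated localization is linear over
    \<open>\<iota>1\<close> on the left and over \<open>\<iota>2\<close> on the right.\<close>
  define j where "j m = j2 (j1 m)" for m
  have j_lact: "j (lact x m) = lact2 (\<iota>1 x) (j m)" for x m
    using loc1 loc2 by (simp add: j_def)
  have j_ract: "j (ract m y) = ract2 (j m) (\<iota>2 y)" for m y
    using loc1 loc2 by (simp add: j_def)
  have \<phi>_right: "\<phi> = ract \<psi> (b P)"
    by (simp add: \<phi> \<psi>)
  \<comment> \<open>Only images of ring elements are moved across \<open>\<psi>\<close>; a fraction
    must first be recombined into such an image, as \<open>Q g^-1 P\<close> is into
    \<open>L\<close>.\<close>
  have j_\<psi>: "lact2 (\<iota>1 x) (j \<psi>) = ract2 (j \<psi>) (\<iota>2 (b x))" for x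
    by (metis j_lact j_ract \<psi>)
  have j_\<phi>: "j \<phi> = lact2 (\<iota>1 P) (j \<psi>)" "j \<phi> = ract2 (j \<psi>) (\<iota>2 (b P))"
    by (simp_all add: \<phi> j_lact j_\<psi>)
  have "lact2 (\<iota>1 P * \<iota>1 Q * rinv (\<iota>1 g)) (j \<phi>) = lact2 (\<iota>1 (P * L)) (j \<psi>)"
    by (simp add: j_\<phi>(1) L_eq fractions_mult [OF frac1] mult.assoc flip: M2.lact_mult)
  also have "\<dots> = ract2 (j \<phi>) (\<iota>2 (b L))"
    by (simp add: j_\<psi> j_\<phi>(2) b_mult fractions_mult [OF frac2] M2.ract_mult)
  finally have first: "lact2 (\<iota>1 P * \<iota>1 Q * rinv (\<iota>1 g)) (j \<phi>) = ract2 (j \<phi>) (\<iota>2 (b L))" .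
  have second: "lact2 (\<iota>1 g) (j \<phi>) = ract2 (j \<phi>) (rinv (\<iota>2 (b L)) * \<iota>2 (b Q) * \<iota>2 (b P))"
    if bL: "b L \<in> regular_elements K2" and P: "P \<in> regular_elements UNIV"
  proof -
    \<comment> \<open>The denominator \<open>b L\<close> lies in \<open>regular_elements K2\<close>,
      so the Ore condition is used in the second algebra and pulled back along \<open>b\<close>. The
      preimage \<open>h\<close> then lies in \<open>A1\<close>, and \<open>\<iota>1 h\<close> need
      not be invertible.\<close>
    obtain h' t' where h': "h' \<in> regular_elements K2" and ht': "h' * b P = t' * b L"
      using ore2 bL unfolding ore_set_def by blast
    obtain h t where h: "h' = b h" and t: "t' = b t"
      using surj_b by (metis surjD)
    have "b (h * P) = b (t * L)"
      using ht' by (simp add: h t b_mult)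
    then have "h * P = t * L"
      using inj_b by (simp add: inj_eq)
    \<comment> \<open>Expanding \<open>L\<close> makes \<open>P\<close> the rightmost factor on both
      sides.\<close>
    then have "\<iota>1 h * \<iota>1 P = (\<iota>1 t * \<iota>1 Q * rinv (\<iota>1 g)) * \<iota>1 P"
      by (metis L_eq fractions_mult [OF frac1] mult.assoc)
    then have "\<iota>1 h = \<iota>1 t * \<iota>1 Q * rinv (\<iota>1 g)"
      by (rule cancel1 [OF P])
    then have "\<iota>1 (h * g) = \<iota>1 (t * Q)"
      by (simp add: fractions_mult [OF frac1] fractions_rinv [OF frac1 g] mult.assoc)
    then have hg: "h * g = t * Q"
      by (simp add: fractions_eq_iff [OF frac1 reg1])
    \<comment> \<open>After applying \<open>b\<close> the factor can be cancelled, since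
      \<open>h'\<close> is one of the inverted denominators.\<close>
    have cancel_h: "u = v" if "\<iota>2 h' * u = \<iota>2 h' * v" for u v
      using that by (metis fractions_rinv(2) [OF frac2 h'] mult.assoc mult_1_left)
    have "\<iota>2 h' * (\<iota>2 (b P) * rinv (\<iota>2 (b L)) * \<iota>2 (b Q)) = \<iota>2 h' * \<iota>2 (b g)"
    proof -
      have "\<iota>2 h' * (\<iota>2 (b P) * rinv (\<iota>2 (b L)) * \<iota>2 (b Q))
          = \<iota>2 (t' * b L) * rinv (\<iota>2 (b L)) * \<iota>2 (b Q)"
        by (simp add: fractions_mult [OF frac2] mult.assoc flip: ht')
      also have "\<dots> = \<iota>2 t' * (\<iota>2 (b L) * rinv (\<iota>2 (b L))) * \<iota>2 (b Q)"
        by (simp only: fractions_mult [OF frac2] mult.assoc)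
      also have "\<dots> = \<iota>2 (b (t * Q))"
        by (simp add: t b_mult fractions_mult [OF frac2] fractions_rinv [OF frac2 bL])
      also have "\<dots> = \<iota>2 h' * \<iota>2 (b g)"
        by (simp add: h b_mult fractions_mult [OF frac2] flip: hg)
      finally show ?thesis .
    qed
    then have bg: "\<iota>2 (b P) * rinv (\<iota>2 (b L)) * \<iota>2 (b Q) = \<iota>2 (b g)"
      by (rule cancel_h)
    have "lact2 (\<iota>1 g) (j \<phi>) = lact2 (\<iota>1 (g * P)) (j \<psi>)"
      by (simp add: j_\<phi>(1) fractions_mult [OF frac1] M2.lact_mult)
    also have "\<dots> = ract2 (j \<psi>) (\<iota>2 (b g) * \<iota>2 (b P))"
      by (simp add: j_\<psi> b_mult fractions_mult [OF frac2])
    \<comment> \<open>The leading \<open>b P\<close> in the expression for \<open>b g\<close> is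
      absorbed into \<open>\<phi>\<close>, as \<open>\<phi>\<close> is
      \<open>\<psi> b(P)\<close>.\<close>
    also have "\<dots> = ract2 (j \<phi>) (rinv (\<iota>2 (b L)) * \<iota>2 (b Q) * \<iota>2 (b P))"
      by (simp add: j_\<phi>(2) mult.assoc flip: bg M2.ract_mult)
    finally show ?thesis .
  qed
  show ?thesis
    using \<phi>_right first second by (simp add: j_def)
qed

end
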